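(* Let $n \ge 1$, $N = 2^n$, and let $f, g : 2^{[n]} \to \mathbb{C}$ be set functions on the subsets of $[n]=\{1,\dots,n\}$. Identify each subset $S \subseteq [n]$ with the integer $\iota(S) = \sum_{j \in S} 2^{j-1} \in \{0,\dots,N-1\}$, so that a set function is a vector of length $N$. Run the following algorithm, in exact arithmetic: (1) For $0 \le i \le n$, form the chopped functions $f^{(i)}, g^{(i)}$, where $f^{(i)}(S) = f(S)$ if $|S| = i$ and $f^{(i)}(S) = 0$ otherwise, and similarly for $g^{(i)}$. Compute their discrete Fourier transforms of length $N$, $\hat f^{(i)} = \mathrm{DFT}(f^{(i)})$ and $\hat g^{(i)} = \mathrm{DFT}(g^{(i)})$. (2) For each $0 \le k \le n$, compute $h^{(k)} = \mathrm{IDFT}\big(\sum_{i=0}^{k} \hat f^{(i)} \cdot \hat g^{(k-i)}\big)$, where $\cdot$ denotes the entrywise product of vectors of length $N$. (3) For each $0 \le k \le n$, set $h^{(k)}(S) := 0$ for every $S \subseteq [n]$ with $|S| \ne k$. (4) Output $h = \sum_{k=0}^{n} h^{(k)}$. Then for every $S \subseteq [n]$, $h(S) = (f \ast g)(S) := \sum_{T \subseteq S} f(T)\, g(S \setminus T)$, i.e., the algorithm correctly computes the subset convolution of $f$ and $g$ in the $(+,\times)$-ring.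
   Context: The discrete Fourier transform of length $N$ of a vector $u = (u_0,\dots,u_{N-1})$ is $\hat u_m = \sum_{t=0}^{N-1} u_t\, \omega^{-mt}$ for $0 \le m \le N-1$, with $\omega = e^{2\pi \mathrm{i}/N}$; IDFT denotes its inverse, $u_t = \frac{1}{N}\sum_{m=0}^{N-1} \hat u_m\, \omega^{mt}$. In step (2), vectors are indexed by $\{0,\dots,N-1\}$ and the entry of index $\iota(S)$ is the value at $S$; no zero-padding is used. *)

theory Defs
  imports Complex_Main "HOL-Library.Nat_Bijection"
begin

text \<open>
  A vector of length \<open>N\<close> is a function on \<^typ>\<open>nat\<close> of which only the entries of index
  below \<open>N\<close> matter. A set function on the subsets of \<open>{1..n}\<close> is a function on \<^typ>\<open>nat set\<close> of
  which only the values on \<^term>\<open>Pow {1..n::nat}\<close> matter.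
\<close>

definition root_omega :: "nat \<Rightarrow> complex" where
  "root_omega N = exp (2 * of_real pi * \<i> / of_nat N)"

definition dft :: "nat \<Rightarrow> (nat \<Rightarrow> complex) \<Rightarrow> nat \<Rightarrow> complex" where
  "dft N u m = (\<Sum>t<N. u t * root_omega N powi (- int (m * t)))"

definition idft :: "nat \<Rightarrow> (nat \<Rightarrow> complex) \<Rightarrow> nat \<Rightarrow> complex" where
  "idft N v t = 1 / of_nat N * (\<Sum>m<N. v m * root_omega N powi int (m * t))"

text \<open>For \<open>S \<subseteq> {1..n}\<close> all elements are at least 1, so the natural number subtraction does not truncate.\<close>

definition iota :: "nat set \<Rightarrow> nat" where
  "iota S = (\<Sum>j\<in>S. 2 ^ (j - 1))"

lemma iota_eq_set_encode:
  assumes "S \<subseteq> {1..n}"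
  shows "iota S = set_encode ((\<lambda>j. j - 1) ` S)"
proof -
  have "inj_on (\<lambda>j. j - 1) S"
    using assms by (intro inj_on_diff_nat) auto
  then show ?thesis
    by (simp add: iota_def set_encode_def sum.reindex)
qed

lemma bij_betw_iota: "bij_betw iota (Pow {1..n}) {..<2 ^ n}"
proof -
  have inj: "inj_on iota (Pow {1..n})"
  proof (rule inj_onI)
    fix S T assume S: "S \<in> Pow {1..n}" and T: "T \<in> Pow {1..n}" and eq: "iota S = iota T"
    have fin: "finite S" "finite T"
      using S T by (auto intro: finite_subset)
    have "set_encode ((\<lambda>j. j - 1) ` S) = set_encode ((\<lambda>j. j - 1) ` T)"
      using S T eq iota_eq_set_encode by (metis PowD)
    then have "(\<lambda>j. j - 1) ` S = (\<lambda>j. j - 1) ` T"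
      using fin by (simp add: set_encode_eq)
    then have "Suc ` (\<lambda>j. j - 1) ` S = Suc ` (\<lambda>j. j - 1) ` T"
      by simp
    moreover have "Suc ` (\<lambda>j. j - 1) ` U = U" if "U \<in> Pow {1..n}" for U
    proof -
      have "(\<lambda>j. Suc (j - 1)) ` U = (\<lambda>j. j) ` U"
        using that by (intro image_cong) auto
      then show ?thesis by (simp add: image_image)
    qed
    ultimately show "S = T" using S T by metis
  qed
  have "iota S < 2 ^ n" if "S \<subseteq> {1..n}" for S
  proof -
    have "iota S \<le> (\<Sum>j\<in>{1..n}. 2 ^ (j - 1))"
      unfolding iota_def using that by (intro sum_mono2) auto
    also have "\<dots> < 2 ^ n"
      by (induction n) auto
    finally show ?thesis .
  qed
  then have "iota ` Pow {1..n} \<subseteq> {..<2 ^ n}" by auto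
  moreover have "card (iota ` Pow {1..n}) = card {..<(2::nat) ^ n}"
    using inj by (simp add: card_image card_Pow)
  ultimately show ?thesis
    using inj by (simp add: bij_betw_def card_subset_eq)
qed

text \<open>The identification of set functions with vectors of length \<open>2 ^ n\<close>, and its inverse.\<close>

definition to_vec :: "nat \<Rightarrow> (nat set \<Rightarrow> complex) \<Rightarrow> nat \<Rightarrow> complex" where
  "to_vec n f t = f (the_inv_into (Pow {1..n}) iota t)"

definition of_vec :: "(nat \<Rightarrow> complex) \<Rightarrow> nat set \<Rightarrow> complex" where
  "of_vec u S = u (iota S)"

lemma to_vec_iota: "S \<subseteq> {1..n} \<Longrightarrow> to_vec n f (iota S) = f S"
  using bij_betw_iota[of n] by (simp add: to_vec_def the_inv_into_f_f bij_betw_def)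

definition chop :: "nat \<Rightarrow> (nat set \<Rightarrow> complex) \<Rightarrow> nat set \<Rightarrow> complex" where
  "chop i f S = (if card S = i then f S else 0)"

definition layer :: "nat \<Rightarrow> (nat set \<Rightarrow> complex) \<Rightarrow> (nat set \<Rightarrow> complex) \<Rightarrow> nat \<Rightarrow> nat \<Rightarrow> complex" where
  "layer n f g k = idft (2 ^ n)
     (\<lambda>m. \<Sum>i\<le>k. dft (2 ^ n) (to_vec n (chop i f)) m * dft (2 ^ n) (to_vec n (chop (k - i) g)) m)"

text \<open>The outer \<^const>\<open>chop\<close> discards the entries of the \<open>k\<close>-th layer at sets of size other than \<open>k\<close>.\<close>

definition dft_subset_convolution ::
    "nat \<Rightarrow> (nat set \<Rightarrow> complex) \<Rightarrow> (nat set \<Rightarrow> complex) \<Rightarrow> nat set \<Rightarrow> complex" where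
  "dft_subset_convolution n f g S = (\<Sum>k\<le>n. chop k (of_vec (layer n f g k)) S)"

definition subset_convolution ::
    "(nat set \<Rightarrow> complex) \<Rightarrow> (nat set \<Rightarrow> complex) \<Rightarrow> nat set \<Rightarrow> complex" where
  "subset_convolution f g S = (\<Sum>T\<in>Pow S. f T * g (S - T))"

end

theory Submission
  imports Defs "HOL-Number_Theory.Cong"
begin

text \<open>
  Multiplying transforms computes the cyclic convolution modulo \<open>2 ^ n\<close>, so the \<open>k\<close>-th layer at
  a set \<open>S\<close> of size \<open>k\<close> collects the products \<open>f A * g B\<close> with \<open>\<bar>A\<bar> + \<bar>B\<bar> = \<bar>S\<bar>\<close> and
  \<open>\<iota>(A) + \<iota>(B) \<equiv> \<iota>(S)\<close>. Every carry in the binary addition, including one lost by the reduction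
  modulo \<open>2 ^ n\<close>, lowers the number of ones. Hence the size condition rules out carries, that is,
  \<open>S\<close> is the disjoint union of \<open>A\<close> and \<open>B\<close>.
\<close>

section \<open>Cyclic convolution\<close>

lemma root_omega_neq_0 [simp]: "root_omega N \<noteq> 0"
  by (simp add: root_omega_def)

lemma root_omega_power: "root_omega N ^ k = cis (2 * pi * real k / real N)"
proof -
  have "root_omega N = cis (2 * pi / real N)"
    by (simp add: root_omega_def cis_conv_exp mult_ac)
  then show ?thesis
    by (simp add: DeMoivre mult_ac)
qed

lemma root_omega_power_self: "N > 0 \<Longrightarrow> root_omega N ^ N = 1"
  by (simp add: root_omega_power)

text \<open>The integer exponents of the transform are reduced to residues below \<open>N\<close>,
  where the library's bijection onto the roots of unity applies.\<close>

lemma root_omega_powi_mod: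
  assumes "N > 0"
  shows "root_omega N powi d = root_omega N ^ nat (d mod int N)"
proof -
  have "root_omega N powi d = root_omega N powi (int N * (d div int N) + d mod int N)"
    by simp
  also have "\<dots> = (root_omega N powi int N) powi (d div int N) * root_omega N powi (d mod int N)"
    by (simp only: power_int_add power_int_mult root_omega_neq_0 simp_thms)
  also have "\<dots> = root_omega N powi int (nat (d mod int N))"
    using assms by (simp add: root_omega_power_self)
  finally show ?thesis
    by (simp only: power_int_of_nat)
qed

lemma root_omega_powi_eq_1_iff:
  assumes "N > 0"
  shows "root_omega N powi d = 1 \<longleftrightarrow> int N dvd d"
proof -
  define r where "r = nat (d mod int N)"
  have "r < N" using assms by (simp add: r_def nat_less_iff)
  have "root_omega N ^ r = 1 \<longleftrightarrow> r = 0"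
    using inj_on_eq_iff[OF bij_betw_imp_inj_on[OF bij_betw_roots_unity[OF assms]], of r 0]
      \<open>r < N\<close> assms by (simp add: root_omega_power)
  \<comment> \<open>Since \<open>nat\<close> also sends negative integers to 0, \<open>r = 0\<close>
    gives \<open>d mod int N = 0\<close> only because the remainder is nonnegative.\<close>
  also have "\<dots> \<longleftrightarrow> int N dvd d"
    using pos_mod_sign[of "int N" d] assms unfolding r_def dvd_eq_mod_eq_0 by linarith
  finally show ?thesis
    using assms by (simp add: root_omega_powi_mod r_def)
qed

text \<open>Orthogonality of characters: \<open>z = root_omega N powi d\<close> satisfies
  \<open>z ^ N = 1\<close>, so the geometric sum of its powers vanishes unless
  \<open>z = 1\<close>.\<close>

lemma sum_root_omega_powi:
  assumes "N > 0"
  shows "(\<Sum>m<N. root_omega N powi (int m * d)) = (if int N dvd d then of_nat N else 0)"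
proof -
  define z where "z = root_omega N powi d"
  have "z ^ N = (root_omega N ^ N) powi d"
    by (simp add: z_def flip: power_int_mult power_int_of_nat) (simp add: mult.commute)
  then have zN: "z ^ N = 1"
    using assms by (simp add: root_omega_power_self)
  have "(\<Sum>m<N. root_omega N powi (int m * d)) = (\<Sum>m<N. z ^ m)"
    by (simp add: z_def flip: power_int_mult power_int_of_nat) (simp add: mult.commute)
  also have "\<dots> = (if z = 1 then of_nat N else 0)"
    using zN by (simp add: geometric_sum)
  finally show ?thesis
    using assms by (simp add: z_def root_omega_powi_eq_1_iff)
qed

lemma idft_sum: "idft N (\<lambda>m. \<Sum>i\<in>I. v i m) t = (\<Sum>i\<in>I. idft N (v i) t)"
  unfolding idft_def sum_distrib_right sum_distrib_left by (rule sum.swap)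

text \<open>The convolution theorem. After expanding both transforms and moving the sum over
  \<open>m\<close> inside, orthogonality selects the pairs with \<open>a + b\<close> congruent to
  \<open>t\<close>; the resulting factor \<open>N\<close> cancels the normalisation of
  \<open>idft\<close>.\<close>

lemma idft_dft_mult:
  assumes "N > 0"
  shows "idft N (\<lambda>m. dft N u m * dft N v m) t =
    (\<Sum>a<N. \<Sum>b<N. if [a + b = t] (mod N) then u a * v b else 0)"
proof -
  let ?w = "root_omega N"
  have "(dft N u m * dft N v m) * ?w powi int (m * t) =
      (\<Sum>a<N. \<Sum>b<N. u a * v b * ?w powi (int m * (int t - int (a + b))))" for m
  proof -
    have "?w powi (int m * (int t - int (a + b))) =
        ?w powi (- int (m * a)) * ?w powi (- int (m * b)) * ?w powi int (m * t)" for a b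
      by (simp add: algebra_simps flip: power_int_add)
    then show ?thesis
      unfolding dft_def sum_product unfolding sum_distrib_right by (simp only: mult_ac)
  qed
  then have "(\<Sum>m<N. (dft N u m * dft N v m) * ?w powi int (m * t)) =
      (\<Sum>m<N. \<Sum>a<N. \<Sum>b<N. u a * v b * ?w powi (int m * (int t - int (a + b))))"
    by simp
  also have "\<dots> = (\<Sum>a<N. \<Sum>m<N. \<Sum>b<N. u a * v b * ?w powi (int m * (int t - int (a + b))))"
    by (rule sum.swap)
  also have "\<dots> = (\<Sum>a<N. \<Sum>b<N. \<Sum>m<N. u a * v b * ?w powi (int m * (int t - int (a + b))))"
    by (intro sum.cong refl sum.swap)
  also have "\<dots> = (\<Sum>a<N. \<Sum>b<N. u a * v b * (if [a + b = t] (mod N) then of_nat N else 0))"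
  proof (intro sum.cong refl)
    fix a b
    have "int N dvd int t - int (a + b) \<longleftrightarrow> [a + b = t] (mod N)"
      by (metis cong_iff_dvd_diff cong_int_iff cong_sym_eq)
    then show "(\<Sum>m<N. u a * v b * ?w powi (int m * (int t - int (a + b)))) =
        u a * v b * (if [a + b = t] (mod N) then of_nat N else 0)"
      using sum_root_omega_powi[OF assms, of "int t - int (a + b)"]
      by (simp only: flip: sum_distrib_left)
  qed
  finally show ?thesis
    using assms by (simp add: idft_def sum_distrib_left if_distrib cong: if_cong)
qed

section \<open>Carries\<close>

text \<open>A free bit \<open>j\<close> is simply set. An occupied one is cleared and a carry moves
  on to \<open>j + 1\<close>, whence the induction on \<open>n - j\<close>. That an occupied bit
  yields no growth in size is what later excludes overlaps.\<close>

lemma add_power2_mod: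
  assumes "P \<subseteq> {1..n}" "j \<in> {1..n}"
  shows "\<exists>Q\<subseteq>{1..n}. [iota P + 2 ^ (j - 1) = iota Q] (mod 2 ^ n) \<and>
    card Q \<le> card P + (if j \<in> P then 0 else 1)"
  using assms
proof (induction "n - j" arbitrary: P j rule: less_induct)
  case less
  have fin: "finite P"
    using less.prems by (auto intro: finite_subset)
  show ?case
  proof (cases "j \<in> P")
    case False
    then have "iota (insert j P) = iota P + 2 ^ (j - 1)"
      using fin by (simp add: iota_def)
    then show ?thesis
      using less.prems False fin by (intro exI[of _ "insert j P"]) auto
  next
    case True
    have "iota P = 2 ^ (j - 1) + iota (P - {j})"
      unfolding iota_def using True fin by (rule sum.remove[rotated])
    moreover have "(2::nat) ^ (j - 1) + 2 ^ (j - 1) = 2 ^ j"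
      using less.prems(2) by (cases j) auto
    ultimately have carry: "iota P + 2 ^ (j - 1) = iota (P - {j}) + 2 ^ j"
      by simp
    have card: "card P = Suc (card (P - {j}))"
      using fin True by (rule card.remove)
    show ?thesis
    proof (cases "j = n")
      \<comment> \<open>The carry out of the top bit is \<open>2 ^ n\<close>, which vanishes modulo
        \<open>2 ^ n\<close>.\<close>
      case True
      then show ?thesis
        unfolding carry using less.prems(1) card by (intro exI[of _ "P - {j}"]) (auto simp: cong_def)
    next
      case False
      then have "n - Suc j < n - j" "P - {j} \<subseteq> {1..n}" "Suc j \<in> {1..n}"
        using less.prems by auto
      from less.hyps[OF this] obtain Q
        where Q: "Q \<subseteq> {1..n}" "[iota (P - {j}) + 2 ^ j = iota Q] (mod 2 ^ n)"
          "card Q \<le> card (P - {j}) + (if Suc j \<in> P - {j} then 0 else 1)"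
        by auto
      \<comment> \<open>Clearing \<open>j\<close> pays for the at most one element that the carry
        adds further up.\<close>
      have "card Q \<le> card P"
        unfolding card by (rule order.trans[OF Q(3)]) simp
      then show ?thesis
        unfolding carry using True Q(1,2) by (intro exI[of _ Q]) simp
    qed
  qed
qed

text \<open>The elements of \<open>B\<close> are added one power of two at a time, each enlarging
  the set by at most one element.\<close>

lemma add_iota_mod:
  assumes "A \<subseteq> {1..n}" "B \<subseteq> {1..n}"
  shows "\<exists>Q\<subseteq>{1..n}. [iota A + iota B = iota Q] (mod 2 ^ n) \<and> card Q \<le> card A + card B"
proof -
  have "finite B" using assms by (auto intro: finite_subset)
  then show ?thesis using assms(2)
  proof (induction B)
    case empty
    then show ?case using assms(1) by (auto simp: iota_def)
  next
    case (insert j B)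
    then obtain Q where Q: "Q \<subseteq> {1..n}" "[iota A + iota B = iota Q] (mod 2 ^ n)"
      "card Q \<le> card A + card B"
      by auto
    obtain R where R: "R \<subseteq> {1..n}" "[iota Q + 2 ^ (j - 1) = iota R] (mod 2 ^ n)"
      "card R \<le> card Q + (if j \<in> Q then 0 else 1)"
      using add_power2_mod[OF Q(1), of j] insert.prems by auto
    have "iota A + iota (insert j B) = (iota A + iota B) + 2 ^ (j - 1)"
      using insert.hyps by (simp add: iota_def)
    then have "[iota A + iota (insert j B) = iota R] (mod 2 ^ n)"
      using cong_trans[OF cong_add[OF Q(2) cong_refl] R(2)] by metis
    moreover have "card R \<le> card A + card (insert j B)"
      using R(3) Q(3) insert.hyps by (simp split: if_splits)
    ultimately show ?case using R(1) by blast
  qed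
qed

lemma iota_cong_imp_eq:
  assumes "S \<subseteq> {1..n}" "T \<subseteq> {1..n}" "[iota S = iota T] (mod 2 ^ n)"
  shows "S = T"
proof -
  have "iota S < 2 ^ n" "iota T < 2 ^ n"
    using assms bij_betw_apply[OF bij_betw_iota[of n]] by auto
  then have "iota S = iota T"
    using assms(3) by (simp add: cong_def)
  then show ?thesis
    using assms bij_betw_iota[of n] by (auto simp: bij_betw_def dest: inj_onD)
qed

lemma iota_disjoint_union:
  assumes "finite A" "finite B" "A \<inter> B = {}"
  shows "iota (A \<union> B) = iota A + iota B"
  using assms by (simp add: iota_def sum.union_disjoint)

text \<open>Carries lose elements, so equality of sizes forces \<open>A\<close> and \<open>B\<close>
  to be disjoint. Then the sum encodes \<open>A \<union> B\<close>, and injectivity of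
  \<open>iota\<close> modulo \<open>2 ^ n\<close> identifies this union with
  \<open>S\<close>.\<close>

lemma add_iota_cong_iff:
  assumes "A \<subseteq> {1..n}" "B \<subseteq> {1..n}" "S \<subseteq> {1..n}"
  shows "[iota A + iota B = iota S] (mod 2 ^ n) \<and> card A + card B = card S \<longleftrightarrow>
    A \<subseteq> S \<and> B = S - A"
proof
  have fin: "finite A" "finite B" "finite S"
    using assms by (auto intro: finite_subset)
  show "[iota A + iota B = iota S] (mod 2 ^ n) \<and> card A + card B = card S"
    if "A \<subseteq> S \<and> B = S - A"
  proof -
    have "A \<union> B = S" "A \<inter> B = {}" using that by auto
    then show ?thesis
      using fin iota_disjoint_union[of A B] card_Un_disjoint[of A B] by simp
  qed
  show "A \<subseteq> S \<and> B = S - A"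
    if *: "[iota A + iota B = iota S] (mod 2 ^ n) \<and> card A + card B = card S"
  proof -
    have disj: "A \<inter> B = {}"
    proof (rule ccontr)
      assume "A \<inter> B \<noteq> {}"
      then obtain j where j: "j \<in> A" "j \<in> B" by auto
      \<comment> \<open>The common element \<open>j\<close> of \<open>B\<close> is added first, at
        no gain in size. The remaining \<open>card B - 1\<close> elements cannot make up for it, so
        the result has fewer than \<open>card A + card B\<close> elements.\<close>
      then obtain P where P: "P \<subseteq> {1..n}" "[iota A + 2 ^ (j - 1) = iota P] (mod 2 ^ n)"
        "card P \<le> card A"
        using add_power2_mod[OF assms(1), of j] assms(1) by (auto simp: subset_iff)
      obtain Q where Q: "Q \<subseteq> {1..n}" "[iota P + iota (B - {j}) = iota Q] (mod 2 ^ n)"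
        "card Q \<le> card P + card (B - {j})"
        using add_iota_mod[OF P(1), of "B - {j}"] assms by auto
      have "iota A + iota B = (iota A + 2 ^ (j - 1)) + iota (B - {j})"
        using j fin by (simp add: iota_def sum.remove)
      then have "[iota A + iota B = iota Q] (mod 2 ^ n)"
        using cong_trans[OF cong_add[OF P(2) cong_refl] Q(2)] by metis
      then have "S = Q"
        using * assms(3) Q(1) by (metis iota_cong_imp_eq cong_sym cong_trans)
      then have "card S = card Q" by simp
      moreover have "card B = Suc (card (B - {j}))"
        using fin(2) j(2) by (rule card.remove)
      ultimately show False
        using * P(3) Q(3) by linarith
    qed
    then have "A \<union> B = S"
      using * assms iota_cong_imp_eq[of "A \<union> B" n S] iota_disjoint_union[OF fin(1,2)] by simp
    with disj show ?thesis by auto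
  qed
qed

section \<open>Layers\<close>

lemma sum_iota: "(\<Sum>a<2 ^ n. F a) = (\<Sum>A\<in>Pow {1..n}. F (iota A))"
  using sum.reindex_bij_betw[OF bij_betw_iota, of F n] by simp

text \<open>Only \<open>i = card A\<close> contributes. As \<open>i \<le> k\<close>, the subtraction
  \<open>k - i\<close> does not truncate; for \<open>card A > k\<close> both sides are 0.\<close>

lemma sum_chop_mult_chop:
  "(\<Sum>i\<le>k. chop i f A * chop (k - i) g B) = (if card A + card B = k then f A * g B else 0)"
proof -
  have "(\<Sum>i\<le>k. chop i f A * chop (k - i) g B) =
      (\<Sum>i\<le>k. if i = card A then (if card B = k - i then f A * g B else 0) else 0)"
    by (intro sum.cong) (auto simp: chop_def)
  also have "\<dots> = (if card A + card B = k then f A * g B else 0)"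
    by auto
  finally show ?thesis .
qed

lemma layer_iota:
  assumes "S \<subseteq> {1..n}"
  shows "layer n f g (card S) (iota S) = subset_convolution f g S"
proof -
  let ?k = "card S" and ?P = "Pow {1..n}"
  let ?C = "\<lambda>A B. [iota A + iota B = iota S] (mod 2 ^ n)"
  have "layer n f g ?k (iota S) =
      (\<Sum>i\<le>?k. \<Sum>A\<in>?P. \<Sum>B\<in>?P. if ?C A B then chop i f A * chop (?k - i) g B else 0)"
    unfolding layer_def
    by (simp add: idft_sum idft_dft_mult sum_iota)
      (intro sum.cong refl if_cong, auto simp: to_vec_iota)
  \<comment> \<open>The sum over \<open>i\<close> moves innermost, where the separate size
    conditions merge into one on \<open>card A + card B\<close>.\<close>
  also have "\<dots> = (\<Sum>A\<in>?P. \<Sum>i\<le>?k. \<Sum>B\<in>?P. if ?C A B then chop i f A * chop (?k - i) g B else 0)"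
    by (rule sum.swap)
  also have "\<dots> = (\<Sum>A\<in>?P. \<Sum>B\<in>?P. \<Sum>i\<le>?k. if ?C A B then chop i f A * chop (?k - i) g B else 0)"
    by (intro sum.cong refl sum.swap)
  also have "\<dots> = (\<Sum>A\<in>?P. \<Sum>B\<in>?P. if ?C A B \<and> card A + card B = ?k then f A * g B else 0)"
  proof (intro sum.cong refl)
    fix A B
    show "(\<Sum>i\<le>?k. if ?C A B then chop i f A * chop (?k - i) g B else 0) =
        (if ?C A B \<and> card A + card B = ?k then f A * g B else 0)"
      by (cases "?C A B") (simp_all add: sum_chop_mult_chop)
  qed
  \<comment> \<open>The nested conditionals put the equation for \<open>B\<close> outermost, so that
    the sum over \<open>B\<close> collapses to a single term.\<close>
  also have "\<dots> = (\<Sum>A\<in>?P. \<Sum>B\<in>?P. if B = S - A then (if A \<subseteq> S then f A * g B else 0) else 0)"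
    using assms by (intro sum.cong refl) (simp add: add_iota_cong_iff)
  also have "\<dots> = (\<Sum>A\<in>?P. if A \<in> Pow S then f A * g (S - A) else 0)"
    using assms by (intro sum.cong refl) auto
  also have "\<dots> = (\<Sum>A\<in>?P \<inter> Pow S. f A * g (S - A))"
    by (rule sum.inter_restrict[symmetric]) simp
  also have "?P \<inter> Pow S = Pow S"
    using assms by auto
  finally show ?thesis
    by (simp add: subset_convolution_def)
qed

theorem theorem1:
  fixes n :: nat and f g :: "nat set \<Rightarrow> complex"
  assumes "n \<ge> 1"
  shows "\<forall>S. S \<subseteq> {1..n} \<longrightarrow> dft_subset_convolution n f g S = subset_convolution f g S"
proof (intro allI impI)
  fix S assume S: "S \<subseteq> {1..n}"
  then have "card S \<le> n"
    using card_mono[of "{1..n}" S] by simp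
  \<comment> \<open>The outer \<open>chop\<close> keeps only the layer \<open>k = card S\<close>,
    which lies in the range of summation because \<open>card S \<le> n\<close>.\<close>
  then have "dft_subset_convolution n f g S = layer n f g (card S) (iota S)"
    by (simp add: dft_subset_convolution_def chop_def of_vec_def)
  with S show "dft_subset_convolution n f g S = subset_convolution f g S"
    by (simp add: layer_iota)
qed

end
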